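(* Assume $\delta>0$ and $(b-a)+\delta>0$, so that both blocks $D$ and $E$ of the excessive decomposition of $T_0$ are present. Then: 1. The intersection of all maximum holes in $T_0$ is exactly the brick $\mathrm{row}(E)\times\mathrm{col}(D)$: $$\bigcap_{V\text{ maximum hole of }T_0}V=\mathrm{row}(E)\times\mathrm{col}(D).$$ 2. The intersection of all minimum proper cover set bricks (MPCS) in $T_0$ is exactly the brick $\mathrm{row}(D)\times\mathrm{col}(E)$: $$\bigcap_{U\text{ MPCS of }T_0}U=\mathrm{row}(D)\times\mathrm{col}(E).$$
   Context: $T_0=B\times A$ is the grid (rows $B$, $|B|=b$; columns $A$, $|A|=a$; $a\le b$) of a finite simple bipartite graph $G_0=(A,B,E)$ without isolated vertices; a dot in cell $(y,x)$ means $x$ and $y$ are adjacent. A brick $T=Y\times X$ (nonempty $Y\subseteq B$, $X\subseteq A$) is a set of cells, identified with the subgraph induced on $X\cup Y$; $\mathrm{row}(T)=Y$, $\mathrm{col}(T)=X$, $\mathrm{vcount}(T)=|X|+|Y|$, $\mathrm{long}(T)=\max\{|X|,|Y|\}$. $T$ is balanced if $|X|=|Y|$, horizontal if $|X|>|Y|$, vertical if $|X|<|Y|$. A hole of $T$ is a dot-free sub-brick $Y'\times X'$ with $\emptyset\neq Y'\subsetneq Y$, $\emptyset\ne X'\subsetneq X$; a maximum hole is one of maximum vcount. $\alpha_p(T)$ is the maximum vcount of a hole of $T$ ($0$ if none). $T$ is excessive if $\mathrm{long}(T)-\alpha_p(T)>0$. $\delta=\max_{X\subseteq A}(|X|-|N(X)|)$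 is the Hall deficiency; when $\alpha_p(T_0)\ge b$ one has $\delta=\alpha_p(T_0)-b$. A covering brick is a brick $W$ with $\mathrm{row}(W)\subsetneq B$, $\mathrm{col}(W)\subsetneq A$ such that $\mathrm{row}(W)\cup\mathrm{col}(W)$ is a vertex cover of $G_0$; an MPCS is a covering brick of minimum vcount. An ordered partition of $T_0$ (its row set and column set both being partitioned) into bricks $B_1,\dots,B_r$ is in block triangular form (BTF) if there is no edge between $\mathrm{row}(B_i)$ and $\mathrm{col}(B_j)$ whenever $i>j$. The excessive decomposition of $T_0$ is the BTF partition, in this order, into excessive bricks $D,C_1,\dots,C_k,E$ (any may be absent) with $D$ horizontal, each $C_i$ balanced, $E$ vertical; it exists and is unique up to the order of the $C$-blocks.
   Formalization: Each balanced block C_i of the excessive decomposition is additionally required to contain a dot; without this, dot-free 1×1 bricks count as excessive, the decomposition is not unique, and claim 1 can fail. *)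

theory Defs
  imports Main "HOL-Library.Disjoint_Sets"
begin

locale bipartite_graph =
  fixes A B :: "'v set" and Ed :: "'v set set"
  assumes finite_A: "finite A" and finite_B: "finite B"
    and disjoint_parts: "A \<inter> B = {}"
    and edges: "\<And>e. e \<in> Ed \<Longrightarrow> \<exists>x\<in>A. \<exists>y\<in>B. e = {x, y}"

definition no_isolated :: "'v set \<Rightarrow> 'v set \<Rightarrow> 'v set set \<Rightarrow> bool" where
  "no_isolated A B Ed \<longleftrightarrow> (\<forall>v\<in>A \<union> B. \<exists>e\<in>Ed. v \<in> e)"

text \<open>A cell is a pair (row, column). A brick is a set of cells; both sides being nonempty, its
  row and column sets are recovered as its domain and range.\<close>

type_synonym 'v brick = "('v \<times> 'v) set"

definition is_brick :: "'v set \<Rightarrow> 'v set \<Rightarrow> 'v brick \<Rightarrow> bool" where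
  "is_brick A B T \<longleftrightarrow>
     (\<exists>Y X. Y \<noteq> {} \<and> Y \<subseteq> B \<and> X \<noteq> {} \<and> X \<subseteq> A \<and> T = Y \<times> X)"

definition row :: "'v brick \<Rightarrow> 'v set" where
  "row T = Domain T"

definition col :: "'v brick \<Rightarrow> 'v set" where
  "col T = Range T"

definition vcount :: "'v brick \<Rightarrow> nat" where
  "vcount T = card (col T) + card (row T)"

definition long_side :: "'v brick \<Rightarrow> nat" where
  "long_side T = max (card (col T)) (card (row T))"

definition balanced :: "'v brick \<Rightarrow> bool" where
  "balanced T \<longleftrightarrow> card (col T) = card (row T)"

definition horizontal :: "'v brick \<Rightarrow> bool" where
  "horizontal T \<longleftrightarrow> card (col T) > card (row T)"

definition vertical :: "'v brick \<Rightarrow> bool" where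
  "vertical T \<longleftrightarrow> card (col T) < card (row T)"

definition dot_free :: "'v set set \<Rightarrow> 'v brick \<Rightarrow> bool" where
  "dot_free Ed T \<longleftrightarrow> (\<forall>(y, x)\<in>T. {x, y} \<notin> Ed)"

definition hole :: "'v set set \<Rightarrow> 'v brick \<Rightarrow> 'v brick \<Rightarrow> bool" where
  "hole Ed T H \<longleftrightarrow>
     (\<exists>Y' X'. Y' \<noteq> {} \<and> Y' \<subset> row T \<and> X' \<noteq> {} \<and> X' \<subset> col T \<and> H = Y' \<times> X') \<and> dot_free Ed H"

definition maximum_hole :: "'v set set \<Rightarrow> 'v brick \<Rightarrow> 'v brick \<Rightarrow> bool" where
  "maximum_hole Ed T H \<longleftrightarrow> is_arg_max vcount (hole Ed T) H"

definition alpha_p :: "'v set set \<Rightarrow> 'v brick \<Rightarrow> nat" where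
  "alpha_p Ed T = (if \<exists>H. hole Ed T H then Max (vcount ` {H. hole Ed T H}) else 0)"

definition excessive :: "'v set set \<Rightarrow> 'v brick \<Rightarrow> bool" where
  "excessive Ed T \<longleftrightarrow> int (long_side T) - int (alpha_p Ed T) > 0"

definition nbhd :: "'v set \<Rightarrow> 'v set set \<Rightarrow> 'v set \<Rightarrow> 'v set" where
  "nbhd B Ed X = {y\<in>B. \<exists>x\<in>X. {x, y} \<in> Ed}"

definition hall_deficiency :: "'v set \<Rightarrow> 'v set \<Rightarrow> 'v set set \<Rightarrow> int" where
  "hall_deficiency A B Ed =
     Max ((\<lambda>X. int (card X) - int (card (nbhd B Ed X))) ` Pow A)"

definition vertex_cover :: "'v set set \<Rightarrow> 'v set \<Rightarrow> bool" where
  "vertex_cover Ed S \<longleftrightarrow> (\<forall>e\<in>Ed. e \<inter> S \<noteq> {})"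

definition covering_brick :: "'v set \<Rightarrow> 'v set \<Rightarrow> 'v set set \<Rightarrow> 'v brick \<Rightarrow> bool" where
  "covering_brick A B Ed W \<longleftrightarrow>
     is_brick A B W \<and> row W \<subset> B \<and> col W \<subset> A \<and> vertex_cover Ed (row W \<union> col W)"

definition MPCS :: "'v set \<Rightarrow> 'v set \<Rightarrow> 'v set set \<Rightarrow> 'v brick \<Rightarrow> bool" where
  "MPCS A B Ed W \<longleftrightarrow> is_arg_min vcount (covering_brick A B Ed) W"

text \<open>Distinctness is required because \<^const>\<open>partition_on\<close> speaks about the set of parts only.\<close>

definition ordered_partition :: "'v set \<Rightarrow> 'v set \<Rightarrow> 'v brick list \<Rightarrow> bool" where
  "ordered_partition A B Bs \<longleftrightarrow>
     (\<forall>T\<in>set Bs. is_brick A B T) \<and>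
     distinct (map row Bs) \<and> partition_on B (set (map row Bs)) \<and>
     distinct (map col Bs) \<and> partition_on A (set (map col Bs))"

definition BTF :: "'v set \<Rightarrow> 'v set \<Rightarrow> 'v set set \<Rightarrow> 'v brick list \<Rightarrow> bool" where
  "BTF A B Ed Bs \<longleftrightarrow> ordered_partition A B Bs \<and>
     (\<forall>i j. j < i \<and> i < length Bs \<longrightarrow>
        (\<forall>y\<in>row (Bs ! i). \<forall>x\<in>col (Bs ! j). {x, y} \<notin> Ed))"

fun opt_list :: "'a option \<Rightarrow> 'a list" where
  "opt_list None = []"
| "opt_list (Some x) = [x]"

text \<open>
  The value \<^const>\<open>None\<close> encodes an absent block.

  The last conjunct only rules out dot-free one-by-one balanced blocks: such a brick has no proper
  hole, hence is formally excessive, while a larger dot-free balanced brick never is. Without this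
  convention the decomposition is not unique. For instance, let the dots be
  (y1,x1), (y1,x2), (y1,x3), (y2,x4), (y3,x4), (y4,x4). The intended decomposition is
  D = {y1} x {x1,x2,x3}, E = {y2,y3,y4} x {x4}, but the empty cell (y2,x3) could otherwise be
  split off as a balanced block between {y1} x {x1,x2} and {y3,y4} x {x4}.
\<close>

definition excessive_decomposition ::
  "'v set \<Rightarrow> 'v set \<Rightarrow> 'v set set \<Rightarrow> 'v brick option \<Rightarrow> 'v brick list \<Rightarrow> 'v brick option \<Rightarrow> bool"
where
  "excessive_decomposition A B Ed D Cs E \<longleftrightarrow>
     BTF A B Ed (opt_list D @ Cs @ opt_list E) \<and>
     (\<forall>T\<in>set (opt_list D @ Cs @ opt_list E). excessive Ed T) \<and>
     (\<forall>T\<in>set_option D. horizontal T) \<and>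
     (\<forall>T\<in>set Cs. balanced T) \<and>
     (\<forall>T\<in>set_option E. vertical T) \<and>
     (\<forall>T\<in>set Cs. \<not> dot_free Ed T)"

end

theory Submission
  imports Defs
begin

text \<open>
  For a pair of sets \<open>X \<subseteq> A\<close>, \<open>Y \<subseteq> B\<close> without edges between them,
  \<open>card X + card Y\<close> is the sum of the contributions of the blocks of the decomposition. Excessiveness
  bounds the contribution of a block by its longer side; in \<open>D\<close> equality forces
  all columns and no row, in \<open>E\<close> all rows and no column. The bounds add up to a total attained by
  \<open>(B - row D) \<times> col D\<close> and by \<open>row E \<times> (A - col E)\<close>, so the maximum holes are the holes
  attaining it: each contains \<open>row E \<times> col D\<close> and avoids \<open>row D\<close> and \<open>col E\<close>, and these two
  already have the claimed intersection. Complementing rows and columns exchanges maximum holes and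
  minimum proper covers.
\<close>

section \<open>Bricks and their two sides\<close>

lemma row_times [simp]: "X \<noteq> {} \<Longrightarrow> row (Y \<times> X) = Y"
  by (auto simp: row_def)

lemma col_times [simp]: "Y \<noteq> {} \<Longrightarrow> col (Y \<times> X) = X"
  by (auto simp: col_def)

lemma dot_free_times: "dot_free Ed (Y \<times> X) \<longleftrightarrow> (\<forall>y\<in>Y. \<forall>x\<in>X. {x, y} \<notin> Ed)"
  by (auto simp: dot_free_def)

lemma dot_free_swap: "dot_free Ed (Y \<times> X) \<Longrightarrow> dot_free Ed (X \<times> Y)"
  unfolding dot_free_times by (metis insert_commute)

lemma is_brick_eq: "is_brick A B T \<Longrightarrow> T = row T \<times> col T"
  by (auto simp: is_brick_def row_def col_def)

lemma is_brick_sides: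
  assumes "is_brick A B T"
  shows "row T \<noteq> {}" "row T \<subseteq> B" "col T \<noteq> {}" "col T \<subseteq> A"
  using assms by (auto simp: is_brick_def row_def col_def)

section \<open>Dot-free pairs inside one excessive brick\<close>

lemma vcount_hole_less_long_side:
  assumes "excessive Ed T" "finite T" "hole Ed T H"
  shows "vcount H < long_side T"
proof -
  \<comment> \<open>\<open>alpha_p\<close> is a \<open>Max\<close>, which bounds its members only
    over a finite set.\<close>
  have "{H. hole Ed T H} \<subseteq> Pow (row T \<times> col T)"
    by (auto simp: hole_def)
  moreover have "finite (row T \<times> col T)"
    using assms(2) by (simp add: row_def col_def finite_Domain finite_Range)
  ultimately have "finite {H. hole Ed T H}"
    by (meson finite_Pow_iff finite_subset)
  then have "vcount H \<le> alpha_p Ed T"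
    using assms(3) by (auto simp: alpha_p_def)
  with assms(1) show ?thesis by (simp add: excessive_def)
qed

text \<open>Excessiveness of \<open>R \<times> K\<close>, in a form that is symmetric in rows and columns.\<close>

definition tight :: "'v set set \<Rightarrow> 'v set \<Rightarrow> 'v set \<Rightarrow> bool" where
  "tight Ed R K \<longleftrightarrow> finite R \<and> finite K \<and> R \<noteq> {} \<and> K \<noteq> {} \<and>
     (\<forall>Y X. Y \<noteq> {} \<longrightarrow> Y \<subset> R \<longrightarrow> X \<noteq> {} \<longrightarrow> X \<subset> K \<longrightarrow> dot_free Ed (Y \<times> X) \<longrightarrow>
        card X + card Y < max (card K) (card R))"

lemma tightD:
  assumes "tight Ed R K" "Y \<noteq> {}" "Y \<subset> R" "X \<noteq> {}" "X \<subset> K" "dot_free Ed (Y \<times> X)"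
  shows "card X + card Y < max (card K) (card R)"
  using assms by (auto simp: tight_def)

text \<open>Transposition turns a vertical block into a horizontal one, so
  \<open>tight_unbalanced_bound\<close> serves both \<open>D\<close> and \<open>E\<close>.\<close>

lemma tight_swap:
  assumes "tight Ed R K" shows "tight Ed K R"
  unfolding tight_def
proof (intro conjI allI impI)
  fix Y X assume "Y \<noteq> {}" "Y \<subset> K" "X \<noteq> {}" "X \<subset> R" "dot_free Ed (Y \<times> X)"
  with tightD[OF assms, of X Y] show "card X + card Y < max (card R) (card K)"
    by (simp add: dot_free_swap add.commute max.commute)
qed (use assms in \<open>auto simp: tight_def\<close>)

lemma tight_brick:
  assumes "excessive Ed T" "is_brick A B T" "finite A" "finite B"
  shows "tight Ed (row T) (col T)"
  unfolding tight_def
proof (intro conjI allI impI)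
  show fin: "finite (row T)" "finite (col T)"
    using is_brick_sides[OF assms(2)] assms(3,4) by (auto intro: finite_subset)
  fix Y X
  assume *: "Y \<noteq> {}" "Y \<subset> row T" "X \<noteq> {}" "X \<subset> col T" "dot_free Ed (Y \<times> X)"
  then have "hole Ed T (Y \<times> X)"
    unfolding hole_def by blast
  moreover have "finite T"
    using fin is_brick_eq[OF assms(2)] by (metis finite_cartesian_product)
  ultimately have "vcount (Y \<times> X) < long_side T"
    using vcount_hole_less_long_side assms(1) by blast
  with * show "card X + card Y < max (card (col T)) (card (row T))"
    by (simp add: vcount_def long_side_def)
qed (use is_brick_sides[OF assms(2)] in auto)

text \<open>If \<open>R\<close> has a second row, deleting one column from \<open>{y} \<times> K\<close> with \<open>y \<in> Y\<close> leaves a hole that is too large, so \<open>R = Y\<close>.\<close>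

lemma tight_dot_free_row:
  assumes t: "tight Ed R K" and le: "card R \<le> card K"
    and Y: "Y \<subseteq> R" "Y \<noteq> {}" and df: "dot_free Ed (Y \<times> K)"
  shows "dot_free Ed (R \<times> K)"
proof -
  from Y obtain y where y: "y \<in> Y" "y \<in> R" by blast
  from t have fin: "finite R" "finite K" and "K \<noteq> {}" by (auto simp: tight_def)
  then obtain x where x: "x \<in> K" by blast
  have "R = {y}"
  proof (rule ccontr)
    assume "R \<noteq> {y}"
    with y have R: "{y} \<subset> R" by blast
    have "card K > 1" using psubset_card_mono[OF fin(1) R] le by simp
    with x fin have eq: "card (K - {x}) + card {y} = card K" by simp
    with \<open>card K > 1\<close> have "K - {x} \<noteq> {}"
      by (metis card.empty is_singletonI is_singleton_altdef add_0 less_irrefl)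
    moreover have "dot_free Ed ({y} \<times> (K - {x}))"
      using df y by (auto simp: dot_free_times)
    ultimately show False
      using tightD[OF t, of "{y}" "K - {x}"] R x le eq by auto
  qed
  with df y show ?thesis by (auto simp: dot_free_times)
qed

text \<open>If both sides are nonempty and one of them is full, \<open>tight_dot_free_row\<close>,
  applied directly or transposed, makes the whole brick dot-free, against \<open>nd\<close>. Two
  proper nonempty sides form a hole, and an empty side is trivial. Without \<open>nd\<close> a
  single empty cell would give 2 against a side of length 1.\<close>

lemma tight_balanced_bound:
  assumes t: "tight Ed R K" and eq: "card R = card K" and nd: "\<not> dot_free Ed (R \<times> K)"
    and sub: "Y \<subseteq> R" "X \<subseteq> K" and df: "dot_free Ed (Y \<times> X)"
  shows "card X + card Y \<le> card K"
proof -
  from t have fin: "finite R" "finite K" by (auto simp: tight_def)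
  consider "X = {}" | "Y = {}" | "X \<noteq> {}" "Y \<noteq> {}" by blast
  then show ?thesis
  proof cases
    case 1
    then show ?thesis using card_mono[OF fin(1) sub(1)] eq by simp
  next
    case 2
    then show ?thesis using card_mono[OF fin(2) sub(2)] by simp
  next
    case 3
    have "X \<noteq> K"
      using tight_dot_free_row[OF t, of Y] eq sub df nd 3 by auto
    moreover have "Y \<noteq> R"
      using tight_dot_free_row[OF tight_swap[OF t], of X] eq sub df nd 3
      by (auto dest: dot_free_swap)
    ultimately show ?thesis
      using tightD[OF t, of Y X] 3 sub df eq by (simp add: psubset_eq)
  qed
qed

text \<open>By \<open>deg\<close> every column of \<open>K\<close> has a dot in \<open>R\<close>, so
  with both sides nonempty neither can be full, and tightness makes the bound strict. If
  \<open>X\<close> is empty, \<open>less\<close> makes it strict as well. Equality is left only for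
  \<open>Y = {}\<close>, where it forces \<open>X = K\<close>.\<close>

lemma tight_unbalanced_bound:
  assumes t: "tight Ed R K" and less: "card R < card K"
    and deg: "\<And>x. x \<in> K \<Longrightarrow> \<exists>y\<in>R. {x, y} \<in> Ed"
    and sub: "Y \<subseteq> R" "X \<subseteq> K" and df: "dot_free Ed (Y \<times> X)"
  shows "card X + card Y \<le> card K \<and> (card X + card Y = card K \<longrightarrow> X = K \<and> Y = {})"
proof -
  from t have fin: "finite R" "finite K" "K \<noteq> {}" by (auto simp: tight_def)
  have nd: "\<not> dot_free Ed (R \<times> X')" if "X' \<subseteq> K" "X' \<noteq> {}" for X'
    using that deg unfolding dot_free_times by blast
  consider "X = {}" | "Y = {}" | "X \<noteq> {}" "Y \<noteq> {}" by blast
  then show ?thesis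
  proof cases
    case 1
    then show ?thesis using card_mono[OF fin(1) sub(1)] less by simp
  next
    case 2
    then show ?thesis
      using card_mono[OF fin(2) sub(2)] card_subset_eq[OF fin(2) sub(2)] by simp
  next
    case 3
    have "X \<noteq> K"
      using tight_dot_free_row[OF t, of Y] less sub df nd[of K] 3 by auto
    moreover have "Y \<noteq> R"
      using nd[of X] sub df 3 by auto
    ultimately show ?thesis
      using tightD[OF t, of Y X] 3 sub df less by (simp add: psubset_eq)
  qed
qed

section \<open>Counting along the blocks of the decomposition\<close>

lemma card_partition_sum_list:
  assumes "finite S" "X \<subseteq> S" "distinct (map f Bs)" "partition_on S (set (map f Bs))"
  shows "card X = (\<Sum>T\<leftarrow>Bs. card (X \<inter> f T))"
proof -
  have "S = \<Union> (f ` set Bs)" and "disjoint (f ` set Bs)"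
    using assms(4) by (auto simp: partition_on_def)
  with assms(2) have X: "(\<Union>T\<in>set Bs. X \<inter> f T) = X" by blast
  \<comment> \<open>Distinct images make list entries and parts correspond one to one, so no part is
    counted twice.\<close>
  have inj: "inj_on f (set Bs)" and "distinct Bs"
    using assms(3) by (auto simp: distinct_map)
  have "card (\<Union>T\<in>set Bs. X \<inter> f T) = (\<Sum>T\<in>set Bs. card (X \<inter> f T))"
  proof (rule card_UN_disjoint)
    show "\<forall>T\<in>set Bs. finite (X \<inter> f T)"
      using assms(1,2) by (auto intro: finite_subset)
    show "\<forall>T\<in>set Bs. \<forall>T'\<in>set Bs. T \<noteq> T' \<longrightarrow> (X \<inter> f T) \<inter> (X \<inter> f T') = {}"
    proof (intro ballI impI)
      fix T T' assume "T \<in> set Bs" "T' \<in> set Bs" "T \<noteq> T'"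
      moreover from this inj have "f T \<noteq> f T'" by (auto dest: inj_onD)
      ultimately have "f T \<inter> f T' = {}"
        using \<open>disjoint (f ` set Bs)\<close> by (auto dest: disjointD)
      then show "(X \<inter> f T) \<inter> (X \<inter> f T') = {}" by blast
    qed
  qed simp
  with X \<open>distinct Bs\<close> show ?thesis
    by (simp add: sum_list_distinct_conv_sum_set)
qed

text \<open>\<open>D\<close> and \<open>E\<close> stay optional here, because the bounds derived in
  this locale are what shows that they are present.\<close>

locale decomposed_graph = bipartite_graph +
  fixes D E :: "'v brick option" and Cs :: "'v brick list"
  assumes no_isolated: "no_isolated A B Ed"
    and decomposition: "excessive_decomposition A B Ed D Cs E"
begin

abbreviation "blocks \<equiv> opt_list D @ Cs @ opt_list E"

lemma
  shows blocks_brick: "T \<in> set blocks \<Longrightarrow> is_brick A B T"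
    and distinct_rows: "distinct (map row blocks)"
    and distinct_cols: "distinct (map col blocks)"
    and partition_rows: "partition_on B (set (map row blocks))"
    and partition_cols: "partition_on A (set (map col blocks))"
    and blocks_excessive: "T \<in> set blocks \<Longrightarrow> excessive Ed T"
    and D_horizontal: "T \<in> set_option D \<Longrightarrow> horizontal T"
    and C_balanced: "T \<in> set Cs \<Longrightarrow> balanced T"
    and E_vertical: "T \<in> set_option E \<Longrightarrow> vertical T"
    and C_not_dot_free: "T \<in> set Cs \<Longrightarrow> \<not> dot_free Ed T"
  using decomposition
  unfolding excessive_decomposition_def BTF_def ordered_partition_def by blast+

lemma blocks_tight: "T \<in> set blocks \<Longrightarrow> tight Ed (row T) (col T)"
  using tight_brick blocks_excessive blocks_brick finite_A finite_B by metis

text \<open>In the form \<open>sorted_wrt\<close> the simplifier splits the triangular condition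
  over Cons and append, which gives facts about the first and last block without indices.\<close>

lemma blocks_sorted: "sorted_wrt (\<lambda>S T. dot_free Ed (row T \<times> col S)) blocks"
  using decomposition
  unfolding excessive_decomposition_def BTF_def sorted_wrt_iff_nth_less dot_free_times by blast

lemma rows_eq: "B = (\<Union>T\<in>set blocks. row T)"
  using partition_rows by (auto simp: partition_on_def)

lemma cols_eq: "A = (\<Union>T\<in>set blocks. col T)"
  using partition_cols by (auto simp: partition_on_def)

lemma card_cols: "X \<subseteq> A \<Longrightarrow> card X = (\<Sum>T\<leftarrow>blocks. card (X \<inter> col T))"
  using card_partition_sum_list finite_A distinct_cols partition_cols by metis

lemma card_rows: "Y \<subseteq> B \<Longrightarrow> card Y = (\<Sum>T\<leftarrow>blocks. card (Y \<inter> row T))"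
  using card_partition_sum_list finite_B distinct_rows partition_rows by metis

lemma card_A: "card A = (\<Sum>T\<leftarrow>blocks. card (col T))"
proof -
  have "(\<Sum>T\<leftarrow>blocks. card (A \<inter> col T)) = (\<Sum>T\<leftarrow>blocks. card (col T))"
    by (rule arg_cong[of _ _ sum_list], rule map_cong[OF refl])
      (use is_brick_sides(4)[OF blocks_brick] in \<open>simp only: Int_absorb1\<close>)
  with card_cols[of A] show ?thesis by simp
qed

lemma card_B: "card B = (\<Sum>T\<leftarrow>blocks. card (row T))"
proof -
  have "(\<Sum>T\<leftarrow>blocks. card (B \<inter> row T)) = (\<Sum>T\<leftarrow>blocks. card (row T))"
    by (rule arg_cong[of _ _ sum_list], rule map_cong[OF refl])
      (use is_brick_sides(2)[OF blocks_brick] in \<open>simp only: Int_absorb1\<close>)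
  with card_rows[of B] show ?thesis by simp
qed

lemma col_has_neighbour:
  assumes "x \<in> A" shows "\<exists>y\<in>B. {x, y} \<in> Ed"
proof -
  from assms no_isolated obtain e where e: "e \<in> Ed" "x \<in> e"
    by (auto simp: no_isolated_def)
  with edges[OF e(1)] disjoint_parts assms show ?thesis by auto
qed

lemma row_has_neighbour:
  assumes "y \<in> B" shows "\<exists>x\<in>A. {x, y} \<in> Ed"
proof -
  from assms no_isolated obtain e where e: "e \<in> Ed" "y \<in> e"
    by (auto simp: no_isolated_def)
  with edges[OF e(1)] disjoint_parts assms show ?thesis by auto
qed

text \<open>\<open>D\<close> comes first, so the rows of all other blocks are dot-free on its
  columns; the neighbour that a column must have lies in \<open>row D'\<close>.\<close>

lemma D_col_has_neighbour:
  assumes "D = Some D'" "x \<in> col D'"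
  shows "\<exists>y\<in>row D'. {x, y} \<in> Ed"
proof -
  have "x \<in> A" using assms cols_eq by auto
  then obtain y where y: "y \<in> B" "{x, y} \<in> Ed" using col_has_neighbour by blast
  then obtain T where "T \<in> set blocks" "y \<in> row T" using rows_eq by auto
  with y assms blocks_sorted have "T = D'"
    by (auto simp: dot_free_times)
  with y \<open>y \<in> row T\<close> show ?thesis by blast
qed

text \<open>\<open>E\<close> comes last, so its rows are dot-free on the columns of all other
  blocks.\<close>

lemma E_row_has_neighbour:
  assumes "E = Some E'" "y \<in> row E'"
  shows "\<exists>x\<in>col E'. {x, y} \<in> Ed"
proof -
  have "y \<in> B" using assms rows_eq by auto
  then obtain x where x: "x \<in> A" "{x, y} \<in> Ed" using row_has_neighbour by blast
  then obtain T where "T \<in> set blocks" "x \<in> col T" using cols_eq by auto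
  with x assms blocks_sorted have "T = E'"
    by (auto simp: dot_free_times sorted_wrt_append)
  with x \<open>x \<in> col T\<close> show ?thesis by blast
qed

lemma D_bound:
  assumes "D = Some D'" "dot_free Ed (Y \<times> X)"
  shows "card (X \<inter> col D') + card (Y \<inter> row D') \<le> card (col D')"
    and "card (X \<inter> col D') + card (Y \<inter> row D') = card (col D') \<Longrightarrow>
      col D' \<subseteq> X \<and> Y \<inter> row D' = {}"
proof -
  have "card (row D') < card (col D')"
    using D_horizontal assms(1) by (simp add: horizontal_def)
  moreover have "dot_free Ed ((Y \<inter> row D') \<times> (X \<inter> col D'))"
    using assms(2) by (auto simp: dot_free_times)
  moreover note D_col_has_neighbour[OF assms(1)]
  moreover have "tight Ed (row D') (col D')" using assms(1) by (simp add: blocks_tight)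
  ultimately have *: "card (X \<inter> col D') + card (Y \<inter> row D') \<le> card (col D') \<and>
    (card (X \<inter> col D') + card (Y \<inter> row D') = card (col D') \<longrightarrow>
      X \<inter> col D' = col D' \<and> Y \<inter> row D' = {})"
    by (intro tight_unbalanced_bound) auto
  from * show "card (X \<inter> col D') + card (Y \<inter> row D') \<le> card (col D')" ..
  show "card (X \<inter> col D') + card (Y \<inter> row D') = card (col D') \<Longrightarrow>
      col D' \<subseteq> X \<and> Y \<inter> row D' = {}"
    using * by blast
qed

text \<open>The estimate for a horizontal block, applied to the transpose of \<open>E'\<close>:
  \<open>row E'\<close> takes the place of \<open>K\<close>.\<close>

lemma E_bound:
  assumes "E = Some E'" "dot_free Ed (Y \<times> X)"
  shows "card (X \<inter> col E') + card (Y \<inter> row E') \<le> card (row E')"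
    and "card (X \<inter> col E') + card (Y \<inter> row E') = card (row E') \<Longrightarrow>
      row E' \<subseteq> Y \<and> X \<inter> col E' = {}"
proof -
  have "card (col E') < card (row E')"
    using E_vertical assms(1) by (simp add: vertical_def)
  moreover have "dot_free Ed ((X \<inter> col E') \<times> (Y \<inter> row E'))"
    using dot_free_swap[OF assms(2)] by (auto simp: dot_free_times)
  moreover have "\<exists>x\<in>col E'. {y, x} \<in> Ed" if "y \<in> row E'" for y
    using E_row_has_neighbour[OF assms(1) that] by (simp add: insert_commute)
  moreover have "tight Ed (col E') (row E')"
    using assms(1) by (simp add: blocks_tight tight_swap)
  ultimately have *: "card (Y \<inter> row E') + card (X \<inter> col E') \<le> card (row E') \<and>
    (card (Y \<inter> row E') + card (X \<inter> col E') = card (row E') \<longrightarrow>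
      Y \<inter> row E' = row E' \<and> X \<inter> col E' = {})"
    by (intro tight_unbalanced_bound) auto
  then show "card (X \<inter> col E') + card (Y \<inter> row E') \<le> card (row E')" by linarith
  assume "card (X \<inter> col E') + card (Y \<inter> row E') = card (row E')"
  with * have "Y \<inter> row E' = row E'" "X \<inter> col E' = {}" by linarith+
  then show "row E' \<subseteq> Y \<and> X \<inter> col E' = {}" by blast
qed

lemma C_bound:
  assumes "T \<in> set Cs" "dot_free Ed (Y \<times> X)"
  shows "card (X \<inter> col T) + card (Y \<inter> row T) \<le> card (col T)"
proof (rule tight_balanced_bound[where R = "row T"])
  show "tight Ed (row T) (col T)" using assms(1) blocks_tight by simp
  show "card (row T) = card (col T)" using assms(1) C_balanced by (simp add: balanced_def)
  have "T = row T \<times> col T" using assms(1) blocks_brick is_brick_eq by force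
  then show "\<not> dot_free Ed (row T \<times> col T)" using assms(1) C_not_dot_free by metis
qed (use assms(2) in \<open>auto simp: dot_free_times\<close>)

lemma blocks_bound:
  assumes "T \<in> set blocks" "dot_free Ed (Y \<times> X)"
  shows "card (X \<inter> col T) + card (Y \<inter> row T) \<le> long_side T"
proof -
  consider "D = Some T" | "T \<in> set Cs" | "E = Some T"
    using assms(1) by (cases D; cases E) auto
  then show ?thesis
    by cases (use D_bound(1) C_bound E_bound(1) assms(2) in \<open>auto simp: long_side_def intro: max.coboundedI1 max.coboundedI2\<close>)
qed

lemma card_split:
  assumes "X \<subseteq> A" "Y \<subseteq> B"
  shows "card X + card Y = (\<Sum>T\<leftarrow>blocks. card (X \<inter> col T) + card (Y \<inter> row T))"
  by (simp only: card_cols[OF assms(1)] card_rows[OF assms(2)] sum_list_addf)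

text \<open>Either side may be empty or full, so the bound also covers pairs that are not holes,
  such as those coming from the Hall deficiency.\<close>

lemma dot_free_bound:
  assumes "X \<subseteq> A" "Y \<subseteq> B" "dot_free Ed (Y \<times> X)"
  shows "card X + card Y \<le> (\<Sum>T\<leftarrow>blocks. long_side T)"
  unfolding card_split[OF assms(1,2)]
  by (rule sum_list_mono) (use blocks_bound assms(3) in blast)

section \<open>Presence of the blocks \<open>D\<close> and \<open>E\<close>\<close>

lemma hall_deficiency_bound:
  "hall_deficiency A B Ed + int (card B) \<le> int (\<Sum>T\<leftarrow>blocks. long_side T)"
proof -
  have "hall_deficiency A B Ed \<in> (\<lambda>X. int (card X) - int (card (nbhd B Ed X))) ` Pow A"
    unfolding hall_deficiency_def by (rule Max_in) (use finite_A in auto)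
  then obtain X where X: "X \<subseteq> A"
    and \<delta>: "hall_deficiency A B Ed = int (card X) - int (card (nbhd B Ed X))" by auto
  have N: "nbhd B Ed X \<subseteq> B" by (auto simp: nbhd_def)
  \<comment> \<open>A set attaining the deficiency and the rows outside its neighbourhood form a
    dot-free pair of size \<delta> + \<open>card B\<close>.\<close>
  have "dot_free Ed ((B - nbhd B Ed X) \<times> X)"
    by (auto simp: dot_free_times nbhd_def)
  then have "card X + card (B - nbhd B Ed X) \<le> (\<Sum>T\<leftarrow>blocks. long_side T)"
    using dot_free_bound X by blast
  moreover have "card (B - nbhd B Ed X) + card (nbhd B Ed X) = card B"
    using N finite_B by (metis card_Diff_subset card_mono finite_subset le_add_diff_inverse2)
  ultimately show ?thesis using \<delta> by linarith
qed

text \<open>Without \<open>D\<close> the rows are a longest side of every block, so the total bound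
  is \<open>card B\<close> and \<delta> cannot be positive.\<close>

lemma D_present:
  assumes "hall_deficiency A B Ed > 0"
  shows "D \<noteq> None"
proof
  assume "D = None"
  then have "long_side T = card (row T)" if "T \<in> set blocks" for T
    using that C_balanced[of T] E_vertical[of T]
    by (cases E) (auto simp: long_side_def balanced_def vertical_def)
  then have "(\<Sum>T\<leftarrow>blocks. long_side T) = card B"
    unfolding card_B by (metis map_cong)
  with hall_deficiency_bound assms show False by simp
qed

text \<open>Without \<open>E\<close> the columns are a longest side of every block, so the total
  bound is \<open>card A\<close>.\<close>

lemma E_present:
  assumes "int (card B) - int (card A) + hall_deficiency A B Ed > 0"
  shows "E \<noteq> None"
proof
  assume "E = None"
  then have "long_side T = card (col T)" if "T \<in> set blocks" for T
    using that C_balanced[of T] D_horizontal[of T]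
    by (cases D) (auto simp: long_side_def balanced_def horizontal_def)
  then have "(\<Sum>T\<leftarrow>blocks. long_side T) = card A"
    unfolding card_A by (metis map_cong)
  with hall_deficiency_bound assms show False by simp
qed

end

section \<open>Maximum holes when both blocks are present\<close>

locale decomposed_graph_both = decomposed_graph A B Ed "Some D" "Some E" Cs
  for A B :: "'v set" and Ed and D E :: "'v brick" and Cs
begin

text \<open>The sum of the longer sides of all blocks, with balanced blocks counted by columns. It
  turns out to be the size of a maximum hole.\<close>

definition max_vcount :: nat where
  "max_vcount = card (col D) + (\<Sum>T\<leftarrow>Cs. card (col T)) + card (row E)"

lemma D_sides: "row D \<noteq> {}" "row D \<subseteq> B" "col D \<noteq> {}" "col D \<subseteq> A"
  using is_brick_sides[OF blocks_brick[of D]] by simp_all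

lemma E_sides: "row E \<noteq> {}" "row E \<subseteq> B" "col E \<noteq> {}" "col E \<subseteq> A"
  using is_brick_sides[OF blocks_brick[of E]] by simp_all

lemma rows_D_E_disjoint: "row D \<inter> row E = {}"
proof -
  \<comment> \<open>Disjointness of the set of parts says nothing about two equal parts; these are
    excluded by distinctness of the list.\<close>
  have "row D \<noteq> row E" using distinct_rows by simp
  moreover have "disjoint (set (map row (opt_list (Some D) @ Cs @ opt_list (Some E))))"
    using partition_rows by (simp only: partition_on_def)
  then have "pairwise disjnt {row D, row E}" by (rule pairwise_subset) auto
  ultimately show ?thesis by (simp add: pairwise_insert disjnt_def)
qed

lemma cols_D_E_disjoint: "col D \<inter> col E = {}"
proof -
  have "col D \<noteq> col E" using distinct_cols by simp
  moreover have "disjoint (set (map col (opt_list (Some D) @ Cs @ opt_list (Some E))))"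
    using partition_cols by (simp only: partition_on_def)
  then have "pairwise disjnt {col D, col E}" by (rule pairwise_subset) auto
  ultimately show ?thesis by (simp add: pairwise_insert disjnt_def)
qed

lemma dot_free_le:
  assumes "X \<subseteq> A" "Y \<subseteq> B" "dot_free Ed (Y \<times> X)"
  shows "card X + card Y \<le> max_vcount"
    and "card X + card Y = max_vcount \<Longrightarrow>
      col D \<subseteq> X \<and> X \<inter> col E = {} \<and> row E \<subseteq> Y \<and> Y \<inter> row D = {}"
proof -
  have split: "card X + card Y = (card (X \<inter> col D) + card (Y \<inter> row D)) +
      (\<Sum>T\<leftarrow>Cs. card (X \<inter> col T) + card (Y \<inter> row T)) +
      (card (X \<inter> col E) + card (Y \<inter> row E))"
    using card_split[OF assms(1,2)] by simp
  have C: "(\<Sum>T\<leftarrow>Cs. card (X \<inter> col T) + card (Y \<inter> row T)) \<le> (\<Sum>T\<leftarrow>Cs. card (col T))"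
    by (rule sum_list_mono) (use C_bound assms(3) in blast)
  note D = D_bound[OF refl assms(3)] and E = E_bound[OF refl assms(3)]
  show "card X + card Y \<le> max_vcount"
    unfolding max_vcount_def using split C D(1) E(1) by linarith
  assume "card X + card Y = max_vcount"
  \<comment> \<open>No group of blocks exceeds its share of \<open>max_vcount\<close>, so attaining
    the total leaves no slack in \<open>D\<close> or in \<open>E\<close>.\<close>
  then have "card (X \<inter> col D) + card (Y \<inter> row D) = card (col D)"
    and "card (X \<inter> col E) + card (Y \<inter> row E) = card (row E)"
    unfolding max_vcount_def using split C D(1) E(1) by linarith+
  with D(2) E(2) show "col D \<subseteq> X \<and> X \<inter> col E = {} \<and> row E \<subseteq> Y \<and> Y \<inter> row D = {}"
    by blast
qed

lemma sum_rows_Cs: "(\<Sum>T\<leftarrow>Cs. card (row T)) = (\<Sum>T\<leftarrow>Cs. card (col T))"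
  by (rule arg_cong[of _ _ sum_list], rule map_cong) (use C_balanced in \<open>auto simp: balanced_def\<close>)

lemma hole_iff:
  "hole Ed (B \<times> A) H \<longleftrightarrow>
    (\<exists>Y X. H = Y \<times> X \<and> Y \<noteq> {} \<and> Y \<subset> B \<and> X \<noteq> {} \<and> X \<subset> A \<and> dot_free Ed (Y \<times> X))"
proof -
  have "A \<noteq> {}" "B \<noteq> {}" using D_sides by auto
  then have "row (B \<times> A) = B" "col (B \<times> A) = A" by simp_all
  then show ?thesis unfolding hole_def by metis
qed

definition left_hole :: "'v brick" where
  "left_hole = (B - row D) \<times> col D"

definition right_hole :: "'v brick" where
  "right_hole = row E \<times> (A - col E)"

text \<open>Dot-free because \<open>D\<close> is the first block. The presence of \<open>E\<close>
  leaves a row outside \<open>row D\<close> and a column outside \<open>col D\<close>, so the hole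
  is nonempty and proper. The count trades rows of the balanced blocks for columns.\<close>

lemma left_hole: "hole Ed (B \<times> A) left_hole" "vcount left_hole = max_vcount"
proof -
  have "dot_free Ed ((B - row D) \<times> col D)"
    using rows_eq blocks_sorted by (auto simp: dot_free_times)
  moreover have ne: "B - row D \<noteq> {}" "B - row D \<subset> B"
    using D_sides E_sides rows_D_E_disjoint by blast+
  moreover have "col D \<subset> A"
    using D_sides E_sides cols_D_E_disjoint by blast
  ultimately show "hole Ed (B \<times> A) left_hole"
    unfolding hole_iff left_hole_def using D_sides by blast
  have "card (B - row D) = card B - card (row D)"
    using D_sides finite_B by (simp add: card_Diff_subset finite_subset)
  also have "\<dots> = (\<Sum>T\<leftarrow>Cs. card (col T)) + card (row E)"
    by (simp add: card_B sum_rows_Cs)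
  finally show "vcount left_hole = max_vcount"
    using ne D_sides by (simp add: vcount_def left_hole_def max_vcount_def)
qed

text \<open>The mirror image: dot-free because \<open>E\<close> is the last block, nonempty and
  proper because \<open>D\<close> is present.\<close>

lemma right_hole: "hole Ed (B \<times> A) right_hole" "vcount right_hole = max_vcount"
proof -
  have "dot_free Ed (row E \<times> (A - col E))"
    using cols_eq blocks_sorted by (auto simp: dot_free_times sorted_wrt_append)
  moreover have ne: "A - col E \<noteq> {}" "A - col E \<subset> A"
    using D_sides E_sides cols_D_E_disjoint by blast+
  moreover have "row E \<subset> B"
    using D_sides E_sides rows_D_E_disjoint by blast
  ultimately show "hole Ed (B \<times> A) right_hole"
    unfolding hole_iff right_hole_def using E_sides by blast
  have "card (A - col E) = card A - card (col E)"
    using E_sides finite_A by (simp add: card_Diff_subset finite_subset)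
  also have "\<dots> = card (col D) + (\<Sum>T\<leftarrow>Cs. card (col T))"
    by (simp add: card_A)
  finally show "vcount right_hole = max_vcount"
    using ne E_sides by (simp add: vcount_def right_hole_def max_vcount_def)
qed

lemma vcount_hole_le:
  assumes "hole Ed (B \<times> A) H"
  shows "vcount H \<le> max_vcount"
proof -
  from assms obtain Y X where "H = Y \<times> X" "Y \<noteq> {}" "Y \<subset> B" "X \<noteq> {}" "X \<subset> A"
    "dot_free Ed (Y \<times> X)"
    unfolding hole_iff by blast
  with dot_free_le(1)[of X Y] show ?thesis by (simp add: vcount_def psubset_imp_subset)
qed

lemma maximum_hole_iff:
  "maximum_hole Ed (B \<times> A) H \<longleftrightarrow> hole Ed (B \<times> A) H \<and> vcount H = max_vcount"
proof -
  have "vcount H = max_vcount" if "vcount left_hole \<le> vcount H" "hole Ed (B \<times> A) H"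
    using that vcount_hole_le[of H] left_hole(2) by simp
  then show ?thesis
    unfolding maximum_hole_def is_arg_max_linorder
    using vcount_hole_le left_hole(1) by auto
qed

lemma maximum_holeE:
  assumes "maximum_hole Ed (B \<times> A) H"
  obtains Y X where "H = Y \<times> X" "col D \<subseteq> X" "X \<inter> col E = {}" "row E \<subseteq> Y" "Y \<inter> row D = {}"
proof -
  from assms obtain Y X where H: "H = Y \<times> X" and "Y \<noteq> {}" "Y \<subset> B" "X \<noteq> {}" "X \<subset> A"
    and "dot_free Ed (Y \<times> X)" "vcount H = max_vcount"
    unfolding maximum_hole_iff hole_iff by blast
  with dot_free_le(2)[of X Y] that[OF H] show thesis
    by (simp add: vcount_def psubset_imp_subset)
qed

lemma Inter_maximum_holes: "\<Inter> {V. maximum_hole Ed (B \<times> A) V} = row E \<times> col D"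
proof
  \<comment> \<open>Two holes suffice: the left one confines the columns to \<open>col D\<close>,
    the right one the rows to \<open>row E\<close>.\<close>
  have "\<Inter> {V. maximum_hole Ed (B \<times> A) V} \<subseteq> left_hole \<inter> right_hole"
    using left_hole right_hole by (auto simp: maximum_hole_iff)
  then show "\<Inter> {V. maximum_hole Ed (B \<times> A) V} \<subseteq> row E \<times> col D"
    by (auto simp: left_hole_def right_hole_def)
  show "row E \<times> col D \<subseteq> \<Inter> {V. maximum_hole Ed (B \<times> A) V}"
    by (auto elim!: maximum_holeE)
qed

section \<open>Complementation between holes and covering bricks\<close>

definition complement_brick :: "'v brick \<Rightarrow> 'v brick" where
  "complement_brick W = (B - row W) \<times> (A - col W)"

lemma vertex_cover_iff:
  assumes "Y \<subseteq> B" "X \<subseteq> A"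
  shows "vertex_cover Ed (Y \<union> X) \<longleftrightarrow> dot_free Ed ((B - Y) \<times> (A - X))"
proof
  assume vc: "vertex_cover Ed (Y \<union> X)"
  show "dot_free Ed ((B - Y) \<times> (A - X))"
    unfolding dot_free_times
  proof (intro ballI)
    fix y x assume "y \<in> B - Y" "x \<in> A - X"
    \<comment> \<open>Disjointness of \<open>A\<close> and \<open>B\<close> keeps the column vertex
      \<open>x\<close> out of \<open>Y\<close> and the row vertex \<open>y\<close> out of
      \<open>X\<close>.\<close>
    then have "{x, y} \<inter> (Y \<union> X) = {}"
      using assms disjoint_parts by blast
    with vc show "{x, y} \<notin> Ed" by (auto simp: vertex_cover_def)
  qed
next
  assume df: "dot_free Ed ((B - Y) \<times> (A - X))"
  show "vertex_cover Ed (Y \<union> X)"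
    unfolding vertex_cover_def
  proof
    fix e assume e: "e \<in> Ed"
    with edges obtain x y where "x \<in> A" "y \<in> B" "e = {x, y}" by blast
    with e df show "e \<inter> (Y \<union> X) \<noteq> {}" by (auto simp: dot_free_times)
  qed
qed

lemma covering_brick_complement:
  assumes "covering_brick A B Ed W"
  shows "hole Ed (B \<times> A) (complement_brick W)"
    and "vcount W + vcount (complement_brick W) = card A + card B"
    and "complement_brick (complement_brick W) = W"
proof -
  from assms have br: "is_brick A B W" and sub: "row W \<subset> B" "col W \<subset> A"
    and vc: "vertex_cover Ed (row W \<union> col W)"
    by (auto simp: covering_brick_def)
  have ne: "row W \<noteq> {}" "col W \<noteq> {}" using is_brick_sides[OF br] by auto
  have "dot_free Ed ((B - row W) \<times> (A - col W))"
    using vc sub by (simp add: vertex_cover_iff psubset_imp_subset)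
  then show "hole Ed (B \<times> A) (complement_brick W)"
    unfolding hole_iff complement_brick_def using ne sub by blast
  have ne': "B - row W \<noteq> {}" "A - col W \<noteq> {}" using sub by auto
  have "card (B - row W) + card (row W) = card B" "card (A - col W) + card (col W) = card A"
    using sub finite_A finite_B
    by (metis card_Diff_subset card_mono finite_subset le_add_diff_inverse2 psubset_imp_subset)+
  with ne' show "vcount W + vcount (complement_brick W) = card A + card B"
    by (simp add: vcount_def complement_brick_def)
  show "complement_brick (complement_brick W) = W"
    \<comment> \<open>A product determines its factors only if both are nonempty; \<open>ne'\<close>
      secures this for the complement.\<close>
    using ne' sub is_brick_eq[OF br, symmetric]
    by (simp add: complement_brick_def double_diff psubset_imp_subset)
qed

lemma hole_complement:
  assumes "hole Ed (B \<times> A) H"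
  shows "covering_brick A B Ed (complement_brick H)"
    and "complement_brick (complement_brick H) = H"
proof -
  from assms obtain Y X where H: "H = Y \<times> X"
    and ne: "Y \<noteq> {}" "X \<noteq> {}" and sub: "Y \<subset> B" "X \<subset> A" and df: "dot_free Ed (Y \<times> X)"
    unfolding hole_iff by (elim exE conjE)
  have c: "complement_brick H = (B - Y) \<times> (A - X)"
    unfolding complement_brick_def H using ne by simp
  have ne': "B - Y \<noteq> {}" "A - X \<noteq> {}" and sub': "B - Y \<subset> B" "A - X \<subset> A"
    using ne sub by blast+
  have dd: "B - (B - Y) = Y" "A - (A - X) = X"
    using sub by blast+
  have "vertex_cover Ed ((B - Y) \<union> (A - X))"
    using df by (simp only: vertex_cover_iff[OF Diff_subset Diff_subset] dd)
  moreover have "is_brick A B ((B - Y) \<times> (A - X))"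
    unfolding is_brick_def using ne' by (intro exI[of _ "B - Y"] exI[of _ "A - X"]) simp
  ultimately show "covering_brick A B Ed (complement_brick H)"
    unfolding covering_brick_def c row_times[OF ne'(2)] col_times[OF ne'(1)]
    using sub' by (intro conjI)
  show "complement_brick (complement_brick H) = H"
    unfolding c unfolding complement_brick_def row_times[OF ne'(2)] col_times[OF ne'(1)] dd H ..
qed

lemma maximum_hole_complement:
  assumes "maximum_hole Ed (B \<times> A) H"
  shows "MPCS A B Ed (complement_brick H)"
proof -
  from assms have H: "hole Ed (B \<times> A) H" "vcount H = max_vcount"
    by (auto simp: maximum_hole_iff)
  note c = hole_complement[OF H(1)]
  have "vcount (complement_brick H) \<le> vcount W" if W: "covering_brick A B Ed W" for W
    \<comment> \<open>Complementary sizes always add up to \<open>card A + card B\<close>, so a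
      cover smaller than the complement of \<open>H\<close> would yield a hole larger than
      \<open>H\<close>.\<close>
    using covering_brick_complement(2)[OF c(1)] covering_brick_complement(2)[OF W]
      vcount_hole_le[OF covering_brick_complement(1)[OF W]] H(2) c(2) by simp
  with c(1) show ?thesis by (simp add: MPCS_def is_arg_min_linorder)
qed

lemma MPCS_complement:
  assumes "MPCS A B Ed W"
  shows "maximum_hole Ed (B \<times> A) (complement_brick W)"
proof -
  from assms have W: "covering_brick A B Ed W"
    and min: "\<And>U. covering_brick A B Ed U \<Longrightarrow> vcount W \<le> vcount U"
    by (auto simp: MPCS_def is_arg_min_linorder)
  note c = hole_complement[OF left_hole(1)]
  \<comment> \<open>Minimality of \<open>W\<close> is tested against the complement of
    \<open>left_hole\<close>, whose size is known.\<close>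
  have "max_vcount \<le> vcount (complement_brick W)"
    using covering_brick_complement(2)[OF c(1)] covering_brick_complement(2)[OF W]
      min[OF c(1)] left_hole(2) c(2) by simp
  with vcount_hole_le covering_brick_complement(1)[OF W] show ?thesis
    by (simp add: maximum_hole_iff le_antisym)
qed

lemma MPCS_supset:
  assumes "MPCS A B Ed W"
  shows "row D \<times> col E \<subseteq> W"
proof -
  have W: "complement_brick (complement_brick W) = W"
    using assms by (auto simp: MPCS_def is_arg_min_linorder covering_brick_complement(3))
  from MPCS_complement[OF assms] obtain Y X where c: "complement_brick W = Y \<times> X"
    and "col D \<subseteq> X" "X \<inter> col E = {}" "row E \<subseteq> Y" "Y \<inter> row D = {}"
    by (rule maximum_holeE)
  \<comment> \<open>Nonempty sides let \<open>row\<close> and \<open>col\<close> of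
    \<open>Y \<times> X\<close> return \<open>Y\<close> and \<open>X\<close>, so the two avoidance
    facts become membership in \<open>B - Y\<close> and \<open>A - X\<close>.\<close>
  moreover from this have "X \<noteq> {}" "Y \<noteq> {}" using D_sides E_sides by auto
  ultimately have "row D \<times> col E \<subseteq> complement_brick (complement_brick W)"
    using D_sides E_sides by (auto simp: complement_brick_def[of "Y \<times> X"])
  with W show ?thesis by simp
qed

lemma Inter_MPCS: "\<Inter> {U. MPCS A B Ed U} = row D \<times> col E"
proof
  have "MPCS A B Ed (complement_brick left_hole)" "MPCS A B Ed (complement_brick right_hole)"
    using left_hole right_hole by (auto intro!: maximum_hole_complement simp: maximum_hole_iff)
  then have "\<Inter> {U. MPCS A B Ed U} \<subseteq> complement_brick left_hole \<inter> complement_brick right_hole"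
    by blast
  \<comment> \<open>The complement of \<open>left_hole\<close> has only rows of \<open>D\<close>,
    that of \<open>right_hole\<close> only columns of \<open>E\<close>.\<close>
  moreover have "row left_hole = B - row D" "col right_hole = A - col E"
    using D_sides E_sides by (simp_all add: left_hole_def right_hole_def)
  ultimately show "\<Inter> {U. MPCS A B Ed U} \<subseteq> row D \<times> col E"
    by (auto simp: complement_brick_def)
  show "row D \<times> col E \<subseteq> \<Inter> {U. MPCS A B Ed U}"
    using MPCS_supset by blast
qed

end

theorem theorem8p11:
  fixes A B :: "'v set" and Ed :: "'v set set"
    and D E :: "'v brick option" and Cs :: "'v brick list"
  assumes "bipartite_graph A B Ed"
    and "no_isolated A B Ed"
    and "card A \<le> card B"
    and "excessive_decomposition A B Ed D Cs E"
    and "hall_deficiency A B Ed > 0"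
    and "(int (card B) - int (card A)) + hall_deficiency A B Ed > 0"
  shows "\<exists>D' E'. D = Some D' \<and> E = Some E' \<and>
    \<Inter> {V. maximum_hole Ed (B \<times> A) V} = row E' \<times> col D' \<and>
    \<Inter> {U. MPCS A B Ed U} = row D' \<times> col E'"
proof -
  have dg: "decomposed_graph A B Ed D E Cs"
    using assms(1,2,4) by (simp add: decomposed_graph_def decomposed_graph_axioms_def)
  obtain D' E' where DE: "D = Some D'" "E = Some E'"
    using decomposed_graph.D_present[OF dg] decomposed_graph.E_present[OF dg] assms(5,6) by auto
  interpret decomposed_graph_both A B Ed D' E' Cs
    using dg DE by (simp add: decomposed_graph_both_def)
  show ?thesis using DE Inter_maximum_holes Inter_MPCS by blast
qed

end
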